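(* Let $0<\nu<\infty$ and let $f:\mathbb{R}\to\mathbb{R}$ be defined by $f(x)=e^{-\frac1{|x|^\nu}}$ for $x\ne0$ and $f(0)=0$. Then $f$ is smooth and there is some $C>0$ such that for all $n\in\mathbb{N}$ $$|f^{(n)}(x)|\le\begin{cases}C^ne^{-\frac1{2|x|^\nu}}(n!)^{1+\frac1\nu},&x\ne0,\\0,&x=0.\end{cases}$$ As a corollary, $f\in G^{1+\frac1\nu}(\mathbb{R})$.
   Context: For $s\ge1$, $G^s(\mathbb{R})=\bigcup_{K>0}G^{s,K}(\mathbb{R})$, where $G^{s,K}(\mathbb{R})$ is the set of smooth $f:\mathbb{R}\to\mathbb{R}$ with $|f|_{s,K}=\frac{4\pi^2}3\sup_{k\ge0}\frac{(1+k)^2}{K^k(k!)^s}\sup_{x\in\mathbb{R}}|\partial^kf(x)|<\infty$. *)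

theory Defs
  imports "HOL-Analysis.Analysis"
begin

definition smooth :: "(real \<Rightarrow> real) \<Rightarrow> bool" where
  "smooth f \<longleftrightarrow> (\<forall>n x. ((deriv ^^ n) f) field_differentiable (at x))"

text \<open>The suprema are taken in \<^typ>\<open>ennreal\<close>, where they always exist, so that finiteness
  of the Gevrey norm is a genuine condition. The function is meant to be smooth; otherwise the
  iterated \<^const>\<open>deriv\<close> has no meaning.\<close>

definition gevrey_norm :: "real \<Rightarrow> real \<Rightarrow> (real \<Rightarrow> real) \<Rightarrow> ennreal" where
  "gevrey_norm s K f =
     ennreal (4 * pi ^ 2 / 3) *
     (SUP k::nat. ennreal ((1 + real k) ^ 2 / (K ^ k * fact k powr s)) *
                  (SUP x::real. ennreal \<bar>(deriv ^^ k) f x\<bar>))"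

definition gevrey_at :: "real \<Rightarrow> real \<Rightarrow> (real \<Rightarrow> real) set" where
  "gevrey_at s K = {f. smooth f \<and> gevrey_norm s K f < \<infinity>}"

definition gevrey :: "real \<Rightarrow> (real \<Rightarrow> real) set" where
  "gevrey s = (\<Union>K\<in>{0<..}. gevrey_at s K)"

end

theory Submission
  imports Defs "HOL-Complex_Analysis.Cauchy_Integral_Formula"
begin

text \<open>
  The function is even, so it suffices to look at \<open>x > 0\<close>. There it is the restriction of the
  holomorphic function \<open>g(z) = exp (-z\<^sup>-\<^sup>\<nu>)\<close> on the right half-plane, and its derivatives can be
  estimated by Cauchy's inequality on a disc whose radius \<open>\<epsilon> x\<close> is proportional to the distance
  from the origin. By homogeneity, \<open>z\<^sup>-\<^sup>\<nu> = x\<^sup>-\<^sup>\<nu> w\<^sup>-\<^sup>\<nu>\<close> with \<open>w = z / x\<close>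
  running over the fixed circle of radius \<open>\<epsilon>\<close> about \<open>1\<close>; for small \<open>\<epsilon>\<close>, chosen once for
  all \<open>x\<close>, the real part of \<open>w\<^sup>-\<^sup>\<nu>\<close> stays above \<open>3/4\<close> there. Hence
  \<open>\<bar>f\<^sup>(\<^sup>n\<^sup>)(x)\<bar> \<le> n! (\<epsilon> x)\<^sup>-\<^sup>n exp (-3/4 x\<^sup>-\<^sup>\<nu>)\<close>.
  Half of the exponent is kept for the final bound; the remaining factor \<open>exp (-1/4 x\<^sup>-\<^sup>\<nu>)\<close> absorbs
  the singular power \<open>x\<^sup>-\<^sup>n\<close> at the price of a geometric factor and of \<open>(n!)\<^sup>1\<^sup>/\<^sup>\<nu>\<close>
  (\<open>exp_minus_powr_le_power\<close>). Together these steps give \<open>higher_deriv_holo_flat_bound\<close>.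

  At the origin, the bound says that every derivative computed away from \<open>0\<close> tends to \<open>0\<close>
  faster than any power of \<open>\<bar>x\<bar>\<close>, so that its extension by \<open>0\<close> is differentiable at \<open>0\<close>
  with derivative \<open>0\<close>. By induction these extensions are the iterated derivatives of the function
  on the whole line. Membership in the Gevrey class then only needs a radius \<open>K\<close> that beats \<open>C\<close> by
  enough to absorb the weight \<open>(1 + k)\<^sup>2\<close>.
\<close>

section \<open>Exponential decay against powers\<close>

lemma power_le_fact_times_exp:
  fixes y :: real
  assumes "0 \<le> y"
  shows "y ^ n \<le> fact n * exp y"
proof -
  have sm: "summable (\<lambda>n. y ^ n /\<^sub>R fact n)"
    by (rule summable_exp_generic)
  have "(\<Sum>k\<in>{n}. y ^ k /\<^sub>R fact k) \<le> (\<Sum>k. y ^ k /\<^sub>R fact k)"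
    using sm assms by (intro sum_le_suminf) auto
  then have "y ^ n / fact n \<le> exp y"
    by (simp add: exp_def divide_inverse mult.commute)
  then show ?thesis by (simp add: divide_le_eq mult.commute)
qed

text \<open>
  The inequality \<open>y\<^sup>n \<le> n! exp y\<close> at \<open>y = \<nu> x\<^sup>-\<^sup>\<nu> / 4\<close>, raised to the power \<open>1/\<nu>\<close>. That power
  turns \<open>y\<^sup>n\<close> into a multiple of \<open>x\<^sup>-\<^sup>n\<close> and cancels the \<open>\<nu>\<close> in the exponent; it is also where the
  additional Gevrey exponent \<open>1/\<nu>\<close> comes from.
\<close>

lemma exp_minus_powr_le_power:
  fixes \<nu> x :: real
  assumes "0 < \<nu>" "0 < x"
  shows "exp (- (x powr - \<nu> / 4)) \<le> ((4 / \<nu>) powr (1 / \<nu>) * x) ^ n * fact n powr (1 / \<nu>)"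
proof -
  define t where "t = x powr - \<nu>"
  define A where "A = (4 / \<nu>) powr (1 / \<nu>)"
  have t: "0 < t" and A: "0 < A" using assms by (auto simp: t_def A_def)
  have "(\<nu> * t / 4) powr (1 / \<nu>) = (\<nu> / 4) powr (1 / \<nu>) * t powr (1 / \<nu>)"
    using assms t by (subst powr_mult [symmetric]) auto
  also have "(\<nu> / 4) powr (1 / \<nu>) = 1 / A"
    using assms by (simp add: A_def powr_divide)
  also have "t powr (1 / \<nu>) = 1 / x"
    using assms by (simp add: t_def powr_powr powr_minus_divide [of x 1])
  finally have root: "(\<nu> * t / 4) powr (1 / \<nu>) = 1 / (A * x)" by simp
  have "(1 / (A * x)) ^ n = ((\<nu> * t / 4) ^ n) powr (1 / \<nu>)"
    unfolding root [symmetric] using assms t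
    by (simp add: powr_powr mult.commute flip: powr_realpow)
  also have "\<dots> \<le> (fact n * exp (\<nu> * t / 4)) powr (1 / \<nu>)"
    using assms t by (intro powr_mono2 power_le_fact_times_exp) auto
  also have "\<dots> = fact n powr (1 / \<nu>) * exp (t / 4)"
    using assms by (simp add: powr_mult exp_powr_real)
  finally have "1 / (A * x) ^ n \<le> fact n powr (1 / \<nu>) * exp (t / 4)"
    by (simp add: power_divide)
  then have "exp (- (t / 4)) \<le> (A * x) ^ n * fact n powr (1 / \<nu>)"
    using A assms by (simp add: exp_minus field_simps)
  then show ?thesis by (simp add: A_def t_def)
qed

section \<open>The holomorphic extension\<close>

definition holo_flat :: "real \<Rightarrow> complex \<Rightarrow> complex" where
  "holo_flat \<nu> z = exp (- (z powr complex_of_real (- \<nu>)))"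

lemma not_nonpos_Reals_if_Re_pos: "0 < Re z \<Longrightarrow> z \<notin> \<real>\<^sub>\<le>\<^sub>0"
  by (auto simp: complex_nonpos_Reals_iff)

lemma holomorphic_holo_flat: "holo_flat \<nu> holomorphic_on {z. 0 < Re z}"
  unfolding holo_flat_def
  by (intro holomorphic_intros) (auto simp: not_nonpos_Reals_if_Re_pos)

text \<open>
  Cauchy's inequality on the disc of radius \<open>\<epsilon> x\<close> about \<open>x\<close>. Because \<open>z\<^sup>-\<^sup>\<nu>\<close> is homogeneous, the choice
  of \<open>\<epsilon>\<close> is a condition at the point \<open>1\<close> alone, where mere continuity supplies it; this is why
  one constant serves all \<open>x\<close> and all \<open>n\<close>.
\<close>

lemma higher_deriv_holo_flat_bound:
  assumes "0 < \<nu>"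
  shows "\<exists>C>0. \<forall>n x. 0 < x \<longrightarrow>
    norm ((deriv ^^ n) (holo_flat \<nu>) (complex_of_real x)) \<le>
      C ^ n * exp (- (1 / (2 * x powr \<nu>))) * fact n powr (1 + 1 / \<nu>)"
proof -
  have "isCont (\<lambda>w. w powr complex_of_real (- \<nu>)) 1"
    by (intro continuous_intros) auto
  then obtain d where d: "0 < d"
    and dw: "\<And>w. dist w 1 < d \<Longrightarrow> dist (w powr complex_of_real (- \<nu>)) (1 powr complex_of_real (- \<nu>)) < 1 / 4"
    unfolding continuous_at_eps_delta by (metis zero_less_divide_1_iff zero_less_numeral)
  define \<epsilon> where "\<epsilon> = min (d / 2) (1 / 2)"
  have \<epsilon>: "0 < \<epsilon>" "\<epsilon> < 1" "\<epsilon> < d" using d by (auto simp: \<epsilon>_def)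
  have near1: "3 / 4 \<le> Re (w powr complex_of_real (- \<nu>))" if "norm (w - 1) = \<epsilon>" for w
  proof -
    have "norm (w powr complex_of_real (- \<nu>) - 1) < 1 / 4"
      using dw [of w] that \<epsilon> by (simp add: dist_norm)
    then show ?thesis
      using abs_Re_le_cmod [of "w powr complex_of_real (- \<nu>) - 1"] by simp
  qed
  define A where "A = (4 / \<nu>) powr (1 / \<nu>)"
  have A: "0 < A" using assms by (simp add: A_def)
  have bound: "norm ((deriv ^^ n) (holo_flat \<nu>) (complex_of_real x)) \<le>
      (A / \<epsilon>) ^ n * exp (- (1 / (2 * x powr \<nu>))) * fact n powr (1 + 1 / \<nu>)"
    if x: "0 < x" for n x
  proof -
    define t where "t = x powr - \<nu>"
    have t: "1 / (2 * x powr \<nu>) = t / 2" by (simp add: t_def powr_minus_divide)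
    have sub: "cball (complex_of_real x) (\<epsilon> * x) \<subseteq> {z. 0 < Re z}"
    proof
      fix z assume "z \<in> cball (complex_of_real x) (\<epsilon> * x)"
      then have "x - Re z \<le> \<epsilon> * x"
        using complex_Re_le_cmod [of "complex_of_real x - z"] by (simp add: dist_norm)
      moreover have "\<epsilon> * x < x" using x \<epsilon> by simp
      ultimately show "z \<in> {z. 0 < Re z}" by simp
    qed
    have circle: "norm (holo_flat \<nu> z) \<le> exp (- (3 / 4 * t))"
      if z: "norm (complex_of_real x - z) = \<epsilon> * x" for z
    proof -
      define w where "w = z / complex_of_real x"
      have zw: "z = complex_of_real x * w" using x by (simp add: w_def)
      have "complex_of_real x - z = complex_of_real x * (1 - w)"
        by (simp add: zw algebra_simps)
      then have "norm (w - 1) = \<epsilon>"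
        using z x by (simp add: norm_mult norm_minus_commute)
      then have "3 / 4 * t \<le> Re (w powr complex_of_real (- \<nu>)) * t"
        using near1 t_def by (intro mult_right_mono) auto
      also have "\<dots> = Re (z powr complex_of_real (- \<nu>))"
        unfolding zw t_def using x
        by (subst powr_times_real_left) (auto simp: powr_of_real simp del: of_real_minus)
      finally show ?thesis by (simp add: holo_flat_def norm_exp_eq_Re)
    qed
    have "norm ((deriv ^^ n) (holo_flat \<nu>) (complex_of_real x)) \<le>
      fact n * exp (- (3 / 4 * t)) / (\<epsilon> * x) ^ n"
    proof (rule Cauchy_inequality)
      show "holo_flat \<nu> holomorphic_on ball (complex_of_real x) (\<epsilon> * x)"
        using holomorphic_holo_flat sub ball_subset_cball by (meson holomorphic_on_subset order_trans)
      show "continuous_on (cball (complex_of_real x) (\<epsilon> * x)) (holo_flat \<nu>)"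
        using holomorphic_holo_flat sub
        by (meson holomorphic_on_subset holomorphic_on_imp_continuous_on)
    qed (use x \<epsilon> circle in auto)
    \<comment> \<open>Half of the exponent survives in the bound, a quarter pays for \<open>x\<^sup>-\<^sup>n\<close>.\<close>
    also have "exp (- (3 / 4 * t)) = exp (- (t / 2)) * exp (- (t / 4))"
      by (simp flip: exp_add)
    also have "fact n * (exp (- (t / 2)) * exp (- (t / 4))) / (\<epsilon> * x) ^ n \<le>
        fact n * (exp (- (t / 2)) * ((A * x) ^ n * fact n powr (1 / \<nu>))) / (\<epsilon> * x) ^ n"
      using exp_minus_powr_le_power [OF assms x, of n] \<epsilon> x
      by (intro divide_right_mono mult_left_mono) (auto simp: A_def t_def)
    also have "\<dots> = (A / \<epsilon>) ^ n * exp (- (t / 2)) * (fact n * fact n powr (1 / \<nu>))"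
      using x \<epsilon> by (simp add: field_simps)
    also have "fact n * fact n powr (1 / \<nu>) = fact n powr (1 + 1 / \<nu>)"
      by (simp add: powr_add)
    finally show ?thesis unfolding t .
  qed
  show ?thesis
    by (rule exI [of _ "A / \<epsilon>"]) (use bound A \<epsilon> in auto)
qed

section \<open>Derivatives on the real line\<close>

text \<open>
  The intended \<open>n\<close>-th derivative, given explicitly before differentiability at the origin is known.
  The sign in the last case reflects that the derivatives of an even function are alternately even
  and odd.
\<close>

definition flat_deriv :: "real \<Rightarrow> nat \<Rightarrow> real \<Rightarrow> real" where
  "flat_deriv \<nu> n x =
     (if x = 0 then 0
      else if 0 < x then Re ((deriv ^^ n) (holo_flat \<nu>) (complex_of_real x))
      else (- 1) ^ n * Re ((deriv ^^ n) (holo_flat \<nu>) (complex_of_real (- x))))"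

lemma flat_deriv_0:
  "flat_deriv \<nu> 0 x = (if x \<noteq> 0 then exp (- (1 / \<bar>x\<bar> powr \<nu>)) else 0)"
proof -
  have "holo_flat \<nu> (complex_of_real y) = complex_of_real (exp (- (1 / y powr \<nu>)))"
    if "0 < y" for y
    unfolding holo_flat_def using that
    by (subst powr_of_real) (auto simp: powr_minus_divide exp_of_real [symmetric])
  from this [of x] this [of "- x"] show ?thesis
    by (auto simp: flat_deriv_def simp del: of_real_minus)
qed

lemma flat_deriv_bound:
  assumes "0 < \<nu>"
  shows "\<exists>C>0. \<forall>n x.
    \<bar>flat_deriv \<nu> n x\<bar> \<le>
      (if x \<noteq> 0
       then C ^ n * exp (- (1 / (2 * \<bar>x\<bar> powr \<nu>))) * fact n powr (1 + 1 / \<nu>)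
       else 0)"
proof -
  obtain C where C: "0 < C" and bd: "\<And>n x. 0 < x \<Longrightarrow>
    norm ((deriv ^^ n) (holo_flat \<nu>) (complex_of_real x)) \<le>
      C ^ n * exp (- (1 / (2 * x powr \<nu>))) * fact n powr (1 + 1 / \<nu>)"
    using higher_deriv_holo_flat_bound [OF assms] by blast
  have eq: "\<bar>flat_deriv \<nu> n x\<bar> = \<bar>Re ((deriv ^^ n) (holo_flat \<nu>) (complex_of_real \<bar>x\<bar>))\<bar>"
    if "x \<noteq> 0" for n x
    using that by (auto simp: flat_deriv_def abs_mult power_abs)
  have "\<bar>flat_deriv \<nu> n x\<bar> \<le>
      C ^ n * exp (- (1 / (2 * \<bar>x\<bar> powr \<nu>))) * fact n powr (1 + 1 / \<nu>)" if "x \<noteq> 0" for n x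
    unfolding eq [OF that] using that by (intro order_trans [OF abs_Re_le_cmod] bd) auto
  with C show ?thesis by (intro exI [of _ C]) (auto simp: flat_deriv_def)
qed

lemma has_field_derivative_0_if_quadratic_bound:
  fixes g :: "real \<Rightarrow> real"
  assumes "\<And>x. \<bar>g x\<bar> \<le> K * x\<^sup>2"
  shows "(g has_field_derivative 0) (at 0)"
proof -
  have g0: "g 0 = 0" using assms [of 0] by simp
  have "((\<lambda>x. g x / x) \<longlongrightarrow> 0) (at 0)"
  proof (rule Lim_null_comparison)
    show "\<forall>\<^sub>F x in at 0. norm (g x / x) \<le> K * \<bar>x\<bar>"
    proof (rule always_eventually, rule allI)
      fix x :: real
      show "norm (g x / x) \<le> K * \<bar>x\<bar>"
        using assms [of x] by (cases "x = 0") (auto simp: field_simps power2_eq_square abs_mult)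
    qed
    show "((\<lambda>x. K * \<bar>x\<bar>) \<longlongrightarrow> 0) (at 0)"
      by (auto intro!: tendsto_eq_intros)
  qed
  then show ?thesis by (simp add: has_field_derivative_iff g0)
qed

lemma Re_higher_deriv_holo_flat_has_derivative:
  assumes "0 < x"
  shows "((\<lambda>y. Re ((deriv ^^ n) (holo_flat \<nu>) (complex_of_real y))) has_field_derivative
    Re ((deriv ^^ Suc n) (holo_flat \<nu>) (complex_of_real x))) (at x)"
proof -
  have op: "open {z. 0 < Re z}" by (rule open_halfspace_Re_gt)
  have "(deriv ^^ n) (holo_flat \<nu>) holomorphic_on {z. 0 < Re z}"
    by (rule holomorphic_higher_deriv [OF holomorphic_holo_flat op])
  from holomorphic_derivI [OF this op, of "complex_of_real x"] assms
  have "((deriv ^^ n) (holo_flat \<nu>) has_field_derivative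
     (deriv ^^ Suc n) (holo_flat \<nu>) (complex_of_real x)) (at (complex_of_real x))"
    by simp
  from has_vector_derivative_real_field [OF this]
  have "((\<lambda>y. (deriv ^^ n) (holo_flat \<nu>) (complex_of_real y)) has_vector_derivative
     (deriv ^^ Suc n) (holo_flat \<nu>) (complex_of_real x)) (at x)" by simp
  from bounded_linear.has_vector_derivative [OF bounded_linear_Re this]
  show ?thesis by (simp add: has_real_derivative_iff_has_vector_derivative)
qed

text \<open>
  Away from the origin this is the derivative of the holomorphic extension along the real axis. At
  the origin the exponential factor in the bound is dominated by a multiple of \<open>x\<^sup>2\<close>, one order more
  than the difference quotient loses.
\<close>

lemma flat_deriv_has_derivative:
  assumes "0 < \<nu>"
  shows "(flat_deriv \<nu> n has_field_derivative flat_deriv \<nu> (Suc n) x) (at x)"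
proof -
  consider "0 < x" | "x < 0" | "x = 0" by linarith
  then show ?thesis
  proof cases
    case 1
    have "(flat_deriv \<nu> n has_field_derivative
        Re ((deriv ^^ Suc n) (holo_flat \<nu>) (complex_of_real x))) (at x)"
      by (rule has_field_derivative_transform_within_open
            [OF Re_higher_deriv_holo_flat_has_derivative [OF 1], where S = "{0<..}"])
         (use 1 in \<open>auto simp: flat_deriv_def\<close>)
    then show ?thesis using 1 by (simp add: flat_deriv_def)
  next
    case 2
    then have "0 < - x" by simp
    from DERIV_mirror [THEN iffD1, OF Re_higher_deriv_holo_flat_has_derivative [OF this, of n \<nu>]]
    have "((\<lambda>y. (- 1) ^ n * Re ((deriv ^^ n) (holo_flat \<nu>) (complex_of_real (- y))))
        has_field_derivative
        (- 1) ^ n * - Re ((deriv ^^ Suc n) (holo_flat \<nu>) (complex_of_real (- x)))) (at x)"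
      by (rule DERIV_cmult)
    from has_field_derivative_transform_within_open [OF this, of "{..<0}" "flat_deriv \<nu> n"]
    have "(flat_deriv \<nu> n has_field_derivative
        (- 1) ^ n * - Re ((deriv ^^ Suc n) (holo_flat \<nu>) (complex_of_real (- x)))) (at x)"
      using 2 by (auto simp: flat_deriv_def)
    then show ?thesis using 2 by (simp add: flat_deriv_def)
  next
    case 3
    obtain C where C: "0 < C" and bd: "\<And>n x. \<bar>flat_deriv \<nu> n x\<bar> \<le>
      (if x \<noteq> 0
       then C ^ n * exp (- (1 / (2 * \<bar>x\<bar> powr \<nu>))) * fact n powr (1 + 1 / \<nu>)
       else 0)"
      using flat_deriv_bound [OF assms] by blast
    define A where "A = (4 / \<nu>) powr (1 / \<nu>)"
    define K where "K = C ^ n * (A\<^sup>2 * 2 powr (1 / \<nu>)) * fact n powr (1 + 1 / \<nu>)"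
    have "\<bar>flat_deriv \<nu> n y\<bar> \<le> K * y\<^sup>2" for y
    proof (cases "y = 0")
      case True
      then show ?thesis by (simp add: flat_deriv_def)
    next
      case False
      have "exp (- (1 / (2 * \<bar>y\<bar> powr \<nu>))) \<le> exp (- (\<bar>y\<bar> powr - \<nu> / 4))"
        using False by (simp add: powr_minus_divide field_simps)
      also have "\<dots> \<le> (A * \<bar>y\<bar>)\<^sup>2 * fact 2 powr (1 / \<nu>)"
        unfolding A_def using False assms by (intro exp_minus_powr_le_power) auto
      also have "\<dots> = A\<^sup>2 * 2 powr (1 / \<nu>) * y\<^sup>2"
        by (simp add: power_mult_distrib)
      finally have e: "exp (- (1 / (2 * \<bar>y\<bar> powr \<nu>))) \<le> A\<^sup>2 * 2 powr (1 / \<nu>) * y\<^sup>2" .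
      have "\<bar>flat_deriv \<nu> n y\<bar> \<le>
          C ^ n * exp (- (1 / (2 * \<bar>y\<bar> powr \<nu>))) * fact n powr (1 + 1 / \<nu>)"
        using bd [of n y] False by simp
      also have "\<dots> \<le> C ^ n * (A\<^sup>2 * 2 powr (1 / \<nu>) * y\<^sup>2) * fact n powr (1 + 1 / \<nu>)"
        using C by (intro mult_right_mono mult_left_mono e) auto
      also have "\<dots> = K * y\<^sup>2" by (simp add: K_def)
      finally show ?thesis .
    qed
    then have "(flat_deriv \<nu> n has_field_derivative 0) (at 0)"
      by (rule has_field_derivative_0_if_quadratic_bound)
    with 3 show ?thesis by (simp add: flat_deriv_def)
  qed
qed

section \<open>Membership in the Gevrey class\<close>

text \<open>
  The radius \<open>K = 4 C\<close> leaves the terms \<open>(1 + k)\<^sup>2 / 4\<^sup>k\<close> in the supremum, and these are at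
  most \<open>1\<close> because \<open>1 + k \<le> 2\<^sup>k\<close>.
\<close>

lemma gevrey_if_derivative_bound:
  assumes "smooth f" "0 < C"
    and bd: "\<And>n x. \<bar>(deriv ^^ n) f x\<bar> \<le> C ^ n * fact n powr s"
  shows "f \<in> gevrey s"
proof -
  have "ennreal ((1 + real k) ^ 2 / ((4 * C) ^ k * fact k powr s)) *
      (SUP x. ennreal \<bar>(deriv ^^ k) f x\<bar>) \<le> 1" for k
  proof -
    have "1 + real k \<le> 2 ^ k"
      using Bernoulli_inequality [of 1 k] by simp
    then have "(1 + real k)\<^sup>2 \<le> (2 ^ k)\<^sup>2" by (intro power_mono) auto
    also have "\<dots> = (4::real) ^ k" by (simp add: power2_eq_square flip: power_mult_distrib)
    finally have k: "(1 + real k)\<^sup>2 \<le> 4 ^ k" .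
    have "(SUP x. ennreal \<bar>(deriv ^^ k) f x\<bar>) \<le> ennreal (C ^ k * fact k powr s)"
      by (intro SUP_least ennreal_leI bd)
    then have "ennreal ((1 + real k) ^ 2 / ((4 * C) ^ k * fact k powr s)) *
        (SUP x. ennreal \<bar>(deriv ^^ k) f x\<bar>) \<le>
        ennreal ((1 + real k) ^ 2 / ((4 * C) ^ k * fact k powr s)) *
        ennreal (C ^ k * fact k powr s)"
      by (intro mult_left_mono) auto
    also have "\<dots> = ennreal ((1 + real k) ^ 2 / ((4 * C) ^ k * fact k powr s) *
        (C ^ k * fact k powr s))"
      using \<open>0 < C\<close> by (intro ennreal_mult [symmetric]) auto
    also have "(1 + real k) ^ 2 / ((4 * C) ^ k * fact k powr s) * (C ^ k * fact k powr s) =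
        (1 + real k) ^ 2 / 4 ^ k"
      using \<open>0 < C\<close> by (simp add: power_mult_distrib field_simps)
    also have "ennreal \<dots> \<le> 1" using k by simp
    finally show ?thesis .
  qed
  then have "gevrey_norm s (4 * C) f \<le> ennreal (4 * pi ^ 2 / 3) * 1"
    unfolding gevrey_norm_def by (intro mult_left_mono SUP_least) auto
  also have "\<dots> < \<infinity>" by simp
  finally have "f \<in> gevrey_at s (4 * C)"
    using assms(1) by (simp add: gevrey_at_def)
  with \<open>0 < C\<close> show ?thesis by (auto simp: gevrey_def)
qed

theorem lemma2p2:
  fixes \<nu> :: real and f :: "real \<Rightarrow> real"
  assumes "0 < \<nu>"
    and "\<And>x. f x = (if x \<noteq> 0 then exp (- (1 / \<bar>x\<bar> powr \<nu>)) else 0)"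
  shows "smooth f \<and>
    (\<exists>C>0. \<forall>(n::nat) (x::real).
       \<bar>(deriv ^^ n) f x\<bar> \<le>
         (if x \<noteq> 0
          then C ^ n * exp (- (1 / (2 * \<bar>x\<bar> powr \<nu>))) * fact n powr (1 + 1 / \<nu>)
          else 0)) \<and>
    f \<in> gevrey (1 + 1 / \<nu>)"
proof -
  have derivs: "(deriv ^^ n) f = flat_deriv \<nu> n" for n
  proof (induction n)
    case 0
    show ?case using assms(2) by (auto simp: flat_deriv_0)
  next
    case (Suc n)
    have "deriv (flat_deriv \<nu> n) = flat_deriv \<nu> (Suc n)"
      by (intro ext DERIV_imp_deriv flat_deriv_has_derivative [OF assms(1)])
    with Suc show ?case by simp
  qed
  have smooth: "smooth f"
    unfolding smooth_def derivs
    using flat_deriv_has_derivative [OF assms(1)] field_differentiable_def by blast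
  obtain C where C: "0 < C" and bd: "\<And>n x. \<bar>(deriv ^^ n) f x\<bar> \<le>
      (if x \<noteq> 0
       then C ^ n * exp (- (1 / (2 * \<bar>x\<bar> powr \<nu>))) * fact n powr (1 + 1 / \<nu>)
       else 0)"
    using flat_deriv_bound [OF assms(1)] unfolding derivs by blast
  have "\<bar>(deriv ^^ n) f x\<bar> \<le> C ^ n * fact n powr (1 + 1 / \<nu>)" for n x
  proof -
    have "C ^ n * exp (- (1 / (2 * \<bar>x\<bar> powr \<nu>))) * fact n powr (1 + 1 / \<nu>) \<le>
        C ^ n * 1 * fact n powr (1 + 1 / \<nu>)"
      using C by (intro mult_right_mono mult_left_mono) auto
    moreover have "0 \<le> C ^ n * fact n powr (1 + 1 / \<nu>)" using C by simp
    ultimately show ?thesis using bd [of n x] by (auto split: if_splits)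
  qed
  then have "f \<in> gevrey (1 + 1 / \<nu>)"
    by (rule gevrey_if_derivative_bound [OF smooth C])
  with smooth C bd show ?thesis by blast
qed

end
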